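(* Let $P_{XY}$ be a probability measure defined on $\mathcal{X}\times\mathcal{Y}$, with $\mathcal{X}$ finite or countably infinite, such that $P_{X|Y}(x|y)>0$ for all $(x,y)\in\mathcal{X}\times\mathcal{Y}$. Then for all $\alpha\in(1,\infty)$, $$\varepsilon_{X|Y}\ge1-\exp\left(\frac{1-\alpha}{\alpha}\,H_\alpha(X|Y)\right).$$
   Context: Logarithms have an arbitrary fixed base larger than 1 and $\exp$ is the inverse of $\log$. $(X,Y)\sim P_{XY}$, with $\mathcal{Y}$ an arbitrary observation space. The Arimoto-R\'enyi conditional entropy of order $\alpha\in(1,\infty)$ is $$H_\alpha(X|Y)=\frac{\alpha}{1-\alpha}\log\mathbb{E}\left[\Bigl(\sum_{x\in\mathcal{X}}P_{X|Y}^\alpha(x|Y)\Bigr)^{1/\alpha}\right],$$ the expectation being over $Y\sim P_Y$. The minimum error probability of guessing $X$ from $Y$ is $\varepsilon_{X|Y}=\min_{\mathcal{L}\colon\mathcal{Y}\to\mathcal{X}}\mathbb{P}[X\ne\mathcal{L}(Y)]=1-\mathbb{E}[\max_{x\in\mathcal{X}}P_{X|Y}(x|Y)]$. *)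

theory Defs
  imports "HOL-Probability.Probability"
begin

text \<open>
  A joint law \<open>P\<close> of \<open>(X, Y)\<close> is a probability measure on the \<open>\<sigma>\<close>-algebra of
  \<open>count_space A \<Otimes>\<^sub>M N\<close>, where \<open>A\<close> is the (countable) alphabet of \<open>X\<close> and \<open>N\<close> is an
  arbitrary measurable space in which \<open>Y\<close> takes its values. Of \<open>N\<close> only the carrier and the
  \<open>\<sigma>\<close>-algebra matter, not its measure.
\<close>

definition obs_law :: "('a \<times> 'b) measure \<Rightarrow> 'b measure \<Rightarrow> 'b measure" where
  "obs_law P N = distr P N snd"

text \<open>
  \<open>q x y\<close> plays the role of \<open>P\<^bsub>X|Y\<^esub>(x | y)\<close>: a regular version of the conditional
  distribution of \<open>X\<close> given \<open>Y\<close>. Such a version is unique only up to \<open>Y\<close>-null sets.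
\<close>

definition cond_pmf_version ::
  "('a \<times> 'b) measure \<Rightarrow> 'a set \<Rightarrow> 'b measure \<Rightarrow> ('a \<Rightarrow> 'b \<Rightarrow> real) \<Rightarrow> bool" where
  "cond_pmf_version P A N q \<longleftrightarrow>
     (\<forall>x\<in>A. q x \<in> borel_measurable N) \<and>
     (\<forall>y\<in>space N. (\<forall>x\<in>A. 0 \<le> q x y) \<and> ((\<lambda>x. q x y) has_sum 1) A) \<and>
     (\<forall>x\<in>A. \<forall>B\<in>sets N. measure P ({x} \<times> B) = (LINT y:B|obs_law P N. q x y))"

definition arimoto_renyi_cond_entropy ::
  "real \<Rightarrow> real \<Rightarrow> ('a \<times> 'b) measure \<Rightarrow> 'a set \<Rightarrow> 'b measure \<Rightarrow> ('a \<Rightarrow> 'b \<Rightarrow> real) \<Rightarrow> real" where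
  "arimoto_renyi_cond_entropy b \<alpha> P A N q =
     \<alpha> / (1 - \<alpha>) *
       log b (LINT y|obs_law P N. (\<Sum>\<^sub>\<infinity>x\<in>A. q x y powr \<alpha>) powr (1 / \<alpha>))"

text \<open>
  Guessing rules have to be measurable for the error event to have a probability
  (\<^const>\<open>measure\<close> is \<open>0\<close> on non-measurable sets). \<open>LEAST\<close> is the minimum of the set of error
  probabilities, which is attained by the maximum a posteriori rule.
\<close>

definition min_error_prob :: "('a \<times> 'b) measure \<Rightarrow> 'a set \<Rightarrow> 'b measure \<Rightarrow> real" where
  "min_error_prob P A N =
     (LEAST e. \<exists>L \<in> N \<rightarrow>\<^sub>M count_space A. e = measure P {(x, y) \<in> space P. x \<noteq> L y})"

end

theory Submission
  imports Defs
begin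

text \<open>
  A guessing rule \<open>L\<close> is correct with probability \<open>E[q (L Y) Y]\<close>, which the maximum a posteriori
  rule maximises. Pointwise, \<open>q (L y) y\<close> is one coordinate of the vector \<open>(q x y)\<^sub>x\<close>, hence at most
  its \<open>\<ell>\<^sup>\<alpha>\<close>-norm; the expectation of this norm is \<open>exp ((1 - \<alpha>) / \<alpha> * H)\<close>.
\<close>

section \<open>Largest terms and measurable maximisers on a countable alphabet\<close>

lemma has_sum_nonneg_member_le:
  fixes f :: "'a \<Rightarrow> real"
  assumes "(f has_sum s) A" "\<And>x. x \<in> A \<Longrightarrow> f x \<ge> 0" "x \<in> A"
  shows "f x \<le> s"
  using finite_sum_le_has_sum[OF assms(1), of "{x}"] assms by auto

text \<open>Fix a term \<open>f x0 > 0\<close>. Since \<open>n\<close> terms of size at least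
  \<open>f x0\<close> sum to at least \<open>n * f x0\<close>, only finitely many fit below
  \<open>s\<close>, and the largest of these is the largest of all. If no term is positive, all of
  them vanish and any index serves. This is what makes a maximum a posteriori guess exist on an
  infinite alphabet.\<close>

lemma has_sum_nonneg_attains_max:
  fixes f :: "'a \<Rightarrow> real"
  assumes sum: "(f has_sum s) A" and nonneg: "\<And>x. x \<in> A \<Longrightarrow> f x \<ge> 0"
    and ne: "A \<noteq> {}"
  shows "\<exists>x\<in>A. \<forall>z\<in>A. f z \<le> f x"
proof (cases "\<exists>x\<in>A. f x > 0")
  case False
  then show ?thesis using nonneg ne by (meson ex_in_conv linorder_not_less order_trans)
next
  case True
  then obtain x0 where x0: "x0 \<in> A" "f x0 > 0" by blast
  define F where "F = {z\<in>A. f z \<ge> f x0}"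
  have fin: "finite F"
  proof (rule ccontr)
    assume inf: "infinite F"
    obtain n :: nat where n: "s < n * f x0"
      using x0(2) reals_Archimedean3 by blast
    obtain G where G: "G \<subseteq> F" "finite G" "card G = n"
      using infinite_arbitrarily_large[OF inf] by blast
    have "n * f x0 = (\<Sum>z\<in>G. f x0)" using G by simp
    also have "\<dots> \<le> sum f G" using G by (intro sum_mono) (auto simp: F_def)
    also have "\<dots> \<le> s"
      using G nonneg by (intro finite_sum_le_has_sum[OF sum]) (auto simp: F_def)
    finally show False using n by simp
  qed
  have "x0 \<in> F" using x0 by (simp add: F_def)
  then have "Max (f ` F) \<in> f ` F" using fin by (intro Max_in) auto
  moreover have "f z \<le> Max (f ` F)" if "z \<in> F" for z using that fin by simp
  ultimately obtain x where x: "x \<in> F" "\<And>z. z \<in> F \<Longrightarrow> f z \<le> f x" by auto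
  have "f z \<le> f x" if "z \<in> A" for z
    using x that by (cases "z \<in> F") (auto simp: F_def)
  then show ?thesis using x(1) by (auto simp: F_def)
qed

text \<open>Ties are broken by the least index in the enumeration \<open>to_nat_on A\<close>. Being
  a maximiser at \<open>y\<close> is a countable conjunction of comparisons between measurable
  functions, so the least index of a maximiser, and with it \<open>L\<close>, depends measurably on
  \<open>y\<close>.\<close>

lemma measurable_argmax:
  fixes q :: "'a \<Rightarrow> 'b \<Rightarrow> real"
  assumes A: "countable A"
    and meas [measurable]: "\<And>x. x \<in> A \<Longrightarrow> q x \<in> borel_measurable N"
    and max: "\<And>y. y \<in> space N \<Longrightarrow> \<exists>x\<in>A. \<forall>z\<in>A. q z y \<le> q x y"
  obtains L where "L \<in> N \<rightarrow>\<^sub>M count_space A"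
    and "\<And>y z. y \<in> space N \<Longrightarrow> z \<in> A \<Longrightarrow> q z y \<le> q (L y) y"
proof -
  define M where "M x y \<longleftrightarrow> x \<in> A \<and> (\<forall>z\<in>A. q z y \<le> q x y)" for x y
  define k where "k y = (LEAST n. \<exists>x. M x y \<and> to_nat_on A x = n)" for y
  define L where "L y = from_nat_into A (k y)" for y
  have M_meas: "Measurable.pred N (M x)" for x
  proof (cases "x \<in> A")
    case True
    then show ?thesis unfolding M_def using A
      by (simp add: pred_intros_countable_bounded)
  qed (simp add: M_def[abs_def])
  have "Measurable.pred N (\<lambda>y. \<exists>x. M x y \<and> to_nat_on A x = n)" for n
  proof -
    \<comment> \<open>\<open>M x y\<close> forces \<open>x \<in> A\<close>, so the quantifier ranges
      over a countable set and the event is a countable union.\<close>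
    have "(\<lambda>y. \<exists>x. M x y \<and> to_nat_on A x = n) = (\<lambda>y. \<exists>x\<in>A. M x y \<and> to_nat_on A x = n)"
      by (auto simp: M_def)
    then show ?thesis using A M_meas
      by (simp add: pred_intros_countable_bounded)
  qed
  then have k_meas: "k \<in> N \<rightarrow>\<^sub>M count_space UNIV"
    unfolding k_def by (rule measurable_Least)
  have M_L: "M (L y) y" if "y \<in> space N" for y
  proof -
    have "\<exists>n x. M x y \<and> to_nat_on A x = n" using max[OF that] by (auto simp: M_def)
    then have "\<exists>x. M x y \<and> to_nat_on A x = k y" unfolding k_def by (rule LeastI_ex)
    then obtain x where x: "M x y" "to_nat_on A x = k y" by blast
    then have "L y = x"
      using A by (metis L_def M_def from_nat_into_to_nat_on)
    then show ?thesis using x by simp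
  qed
  show thesis
  proof
    show "L \<in> N \<rightarrow>\<^sub>M count_space A"
    proof (rule measurableI)
      fix y assume "y \<in> space N"
      then show "L y \<in> space (count_space A)" using M_L by (auto simp: M_def)
    next
      fix B
      \<comment> \<open>\<open>L\<close> factors through the natural number \<open>k y\<close>, and
        every set of naturals is measurable.\<close>
      have "L -` B \<inter> space N = k -` (from_nat_into A -` B) \<inter> space N"
        by (auto simp: L_def)
      then show "L -` B \<inter> space N \<in> sets N"
        using measurable_sets[OF k_meas] by simp
    qed
    show "q z y \<le> q (L y) y" if "y \<in> space N" "z \<in> A" for y z
      using M_L that by (auto simp: M_def)
  qed
qed

lemma measurable_apply_countable:
  assumes "countable A" and [measurable]: "\<And>x. x \<in> A \<Longrightarrow> q x \<in> N \<rightarrow>\<^sub>M K"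
    and L: "L \<in> N \<rightarrow>\<^sub>M count_space A"
  shows "(\<lambda>y. q (L y) y) \<in> N \<rightarrow>\<^sub>M K"
  using measurable_compose_countable'[OF _ L \<open>countable A\<close>, of q K] assms(2) by simp

section \<open>Sums of powers over the alphabet\<close>

text \<open>The terms of a probability vector lie in \<open>[0, 1]\<close>, where raising to an
  exponent above 1 does not increase them. Comparison with the original sum gives both
  claims.\<close>

lemma powr_summable_on:
  fixes f :: "'a \<Rightarrow> real"
  assumes sum: "(f has_sum 1) A" and nonneg: "\<And>x. x \<in> A \<Longrightarrow> 0 \<le> f x" and "\<alpha> > 1"
  shows "(\<lambda>x. f x powr \<alpha>) summable_on A"
    and "(\<Sum>\<^sub>\<infinity>x\<in>A. f x powr \<alpha>) \<le> 1"
proof -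
  have le: "f x powr \<alpha> \<le> f x" if "x \<in> A" for x
    using powr_mono'[of 1 \<alpha> "f x"] has_sum_nonneg_member_le[OF sum nonneg that] nonneg[OF that]
      \<open>\<alpha> > 1\<close> by simp
  show s: "(\<lambda>x. f x powr \<alpha>) summable_on A"
    by (rule summable_on_comparison_test[OF has_sum_imp_summable[OF sum]]) (auto simp: le)
  show "(\<Sum>\<^sub>\<infinity>x\<in>A. f x powr \<alpha>) \<le> 1"
    using infsum_mono[OF s has_sum_imp_summable[OF sum] le] infsumI[OF sum] by simp
qed

text \<open>One power is at most the sum of all powers, and taking the \<alpha>-th root preserves
  the order. This is the only inequality that introduces \<alpha> into the bound.\<close>

lemma member_le_powr_infsum:
  fixes f :: "'a \<Rightarrow> real"
  assumes sum: "(f has_sum 1) A" and nonneg: "\<And>x. x \<in> A \<Longrightarrow> 0 \<le> f x" and "\<alpha> > 1"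
    and x: "x \<in> A"
  shows "f x \<le> (\<Sum>\<^sub>\<infinity>x\<in>A. f x powr \<alpha>) powr (1 / \<alpha>)"
proof -
  have "f x powr \<alpha> \<le> (\<Sum>\<^sub>\<infinity>x\<in>A. f x powr \<alpha>)"
    using has_sum_nonneg_member_le[OF has_sum_infsum[OF powr_summable_on(1)[OF sum nonneg \<open>\<alpha> > 1\<close>]], of x] x
    by simp
  then have "(f x powr \<alpha>) powr (1 / \<alpha>) \<le> (\<Sum>\<^sub>\<infinity>x\<in>A. f x powr \<alpha>) powr (1 / \<alpha>)"
    using \<open>\<alpha> > 1\<close> by (intro powr_mono2) auto
  then show ?thesis using \<open>\<alpha> > 1\<close> nonneg[OF x] by (simp add: powr_powr)
qed

text \<open>The sum is an integral against the counting measure, which is sigma-finite on a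
  countable set; such an integral is measurable in its parameter.\<close>

lemma borel_measurable_infsum_countable:
  fixes f :: "'a \<Rightarrow> 'b \<Rightarrow> real"
  assumes A: "countable A" and f: "\<And>x. x \<in> A \<Longrightarrow> f x \<in> borel_measurable N"
    and sum: "\<And>y. y \<in> space N \<Longrightarrow> (\<lambda>x. f x y) summable_on A"
  shows "(\<lambda>y. \<Sum>\<^sub>\<infinity>x\<in>A. f x y) \<in> borel_measurable N"
proof -
  interpret sigma_finite_measure "count_space A"
    using A by (rule sigma_finite_measure_count_space_countable)
  \<comment> \<open>Joint measurability is checked section by section with the countable factor in
    front; the swap moves it to second place, where the integration variable has to stand.\<close>
  have "(\<lambda>(y, x). f x y) \<in> borel_measurable (N \<Otimes>\<^sub>M count_space A)"
    by (rule measurable_pair_swap_iff[THEN iffD2], rule measurable_pair_measure_countable1[OF A])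
      (simp add: f)
  then have "(\<lambda>y. LINT x|count_space A. f x y) \<in> borel_measurable N"
    by (rule borel_measurable_lebesgue_integral)
  moreover have "(LINT x|count_space A. f x y) = (\<Sum>\<^sub>\<infinity>x\<in>A. f x y)" if y: "y \<in> space N" for y
  proof -
    have "(\<lambda>x. norm (f x y)) summable_on A"
      using sum[OF y] by (rule summable_on_iff_abs_summable_on_real[THEN iffD1])
    \<comment> \<open>The bridge is \<open>infsetsum\<close>, which is by definition the
      counting-measure integral and agrees with \<open>infsum\<close> on absolutely summable
      families.\<close>
    then have "(\<Sum>\<^sub>ax\<in>A. f x y) = (\<Sum>\<^sub>\<infinity>x\<in>A. f x y)"
      by (intro infsetsum_infsum abs_summable_equivalent[THEN iffD1])
    then show ?thesis by (simp add: infsetsum_def)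
  qed
  ultimately show ?thesis by (simp cong: measurable_cong)
qed

section \<open>The joint law and its conditional version\<close>

locale joint_law = prob_space P for P :: "('a \<times> 'b) measure" +
  fixes A :: "'a set" and N :: "'b measure" and q :: "'a \<Rightarrow> 'b \<Rightarrow> real"
  assumes countable_alphabet: "countable A"
    and sets_P: "sets P = sets (count_space A \<Otimes>\<^sub>M N)"
    and cond_version: "cond_pmf_version P A N q"
begin

lemma space_P: "space P = A \<times> space N"
  using sets_eq_imp_space_eq[OF sets_P] by (simp add: space_pair_measure)

lemma sets_obs_law [simp, measurable_cong]: "sets (obs_law P N) = sets N"
  by (simp add: obs_law_def)

lemma space_obs_law [simp]: "space (obs_law P N) = space N"
  by (simp add: obs_law_def)

lemma snd_measurable: "snd \<in> P \<rightarrow>\<^sub>M N"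
  using measurable_cong_sets[OF sets_P, of N N] by simp

lemma prob_space_obs_law: "prob_space (obs_law P N)"
  unfolding obs_law_def by (rule prob_space_distr[OF snd_measurable])

lemma q_measurable: "x \<in> A \<Longrightarrow> q x \<in> borel_measurable N"
  and q_nonneg: "x \<in> A \<Longrightarrow> y \<in> space N \<Longrightarrow> 0 \<le> q x y"
  and q_has_sum: "y \<in> space N \<Longrightarrow> ((\<lambda>x. q x y) has_sum 1) A"
  and q_version: "x \<in> A \<Longrightarrow> B \<in> sets N \<Longrightarrow>
    measure P ({x} \<times> B) = (LINT y:B|obs_law P N. q x y)"
  using cond_version by (auto simp: cond_pmf_version_def)

lemma q_le_1: "x \<in> A \<Longrightarrow> y \<in> space N \<Longrightarrow> q x y \<le> 1"
  using has_sum_nonneg_member_le[OF q_has_sum] q_nonneg by blast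

lemma alphabet_nonempty: "A \<noteq> {}"
  using not_empty by (auto simp: space_P)

lemma integrable_obs_law:
  fixes f :: "'b \<Rightarrow> real"
  assumes "f \<in> borel_measurable N" and "\<And>y. y \<in> space N \<Longrightarrow> 0 \<le> f y \<and> f y \<le> 1"
  shows "integrable (obs_law P N) f"
proof -
  interpret obs: prob_space "obs_law P N" by (rule prob_space_obs_law)
  show ?thesis
    using assms by (intro obs.integrable_const_bound[of _ 1]) auto
qed

text \<open>The defining property of the version \<open>q\<close>, recast as a nonnegative integral
  so that summation over the alphabet can later be exchanged with integration by Tonelli.
  Boundedness of \<open>q\<close> by 1 ensures that the two kinds of integral agree.\<close>

lemma emeasure_rectangle:
  assumes x: "x \<in> A" and B: "B \<in> sets N"
  shows "emeasure P ({x} \<times> B) = (\<integral>\<^sup>+y. ennreal (q x y) * indicator B y \<partial>obs_law P N)"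
proof -
  have i: "integrable (obs_law P N) (\<lambda>y. indicator B y * q x y)"
    using q_measurable[OF x] B q_nonneg[OF x] q_le_1[OF x]
    by (intro integrable_obs_law) (auto simp: indicator_def)
  have "emeasure P ({x} \<times> B) = ennreal (LINT y|obs_law P N. indicator B y * q x y)"
    using q_version[OF x B] by (simp add: emeasure_eq_measure set_lebesgue_integral_def)
  also have "\<dots> = (\<integral>\<^sup>+y. ennreal (indicator B y * q x y) \<partial>obs_law P N)"
    by (rule nn_integral_eq_integral[OF i, symmetric])
      (auto simp: q_nonneg[OF x])
  also have "\<dots> = (\<integral>\<^sup>+y. ennreal (q x y) * indicator B y \<partial>obs_law P N)"
    by (rule nn_integral_cong) (auto simp: indicator_def)
  finally show ?thesis .
qed

section \<open>Success and error probabilities of guessing rules\<close>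

text \<open>The event of a correct guess is the countable disjoint union of the rectangles
  \<open>{x} \<times> B x\<close>, with \<open>B x\<close> the set where \<open>L\<close> guesses
  \<open>x\<close>. Countable additivity and Tonelli turn its probability into an integral over
  \<open>y\<close> of a sum over \<open>x\<close>.\<close>

lemma prob_correct:
  assumes L: "L \<in> N \<rightarrow>\<^sub>M count_space A"
  shows "{(x, y) \<in> space P. x = L y} \<in> sets P"
    and "integrable (obs_law P N) (\<lambda>y. q (L y) y)"
    and "measure P {(x, y) \<in> space P. x = L y} = (LINT y|obs_law P N. q (L y) y)"
proof -
  define B where "B x = L -` {x} \<inter> space N" for x
  have B: "B x \<in> sets N" if "x \<in> A" for x
    unfolding B_def using measurable_sets[OF L, of "{x}"] that by simp
  have LA: "L y \<in> A" if "y \<in> space N" for y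
    using measurable_space[OF L that] by simp
  have rect: "{x} \<times> B x \<in> sets P" if "x \<in> A" for x
    unfolding sets_P using that B by (intro pair_measureI) auto
  have eq: "{(x, y) \<in> space P. x = L y} = (\<Union>x\<in>A. {x} \<times> B x)"
    by (auto simp: space_P B_def)
  show "{(x, y) \<in> space P. x = L y} \<in> sets P"
    unfolding eq using rect countable_alphabet by (intro sets.countable_UN') auto
  have meas: "(\<lambda>y. q (L y) y) \<in> borel_measurable N"
    using countable_alphabet q_measurable L by (rule measurable_apply_countable)
  show i: "integrable (obs_law P N) (\<lambda>y. q (L y) y)"
    using meas LA q_nonneg q_le_1 by (intro integrable_obs_law) auto
  have "emeasure P {(x, y) \<in> space P. x = L y}
      = (\<integral>\<^sup>+x. emeasure P ({x} \<times> B x) \<partial>count_space A)"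
    unfolding eq using rect countable_alphabet
    by (intro emeasure_UN_countable) (auto simp: disjoint_family_on_def)
  also have "\<dots> = (\<integral>\<^sup>+x. \<integral>\<^sup>+y. ennreal (q x y) * indicator (B x) y \<partial>obs_law P N \<partial>count_space A)"
    by (rule nn_integral_cong) (simp add: emeasure_rectangle B)
  also have "\<dots> = (\<integral>\<^sup>+y. \<integral>\<^sup>+x. ennreal (q x y) * indicator (B x) y \<partial>count_space A \<partial>obs_law P N)"
  proof (rule nn_integral_count_space_nn_integral[symmetric])
    show "(\<lambda>y. ennreal (q x y) * indicator (B x) y) \<in> borel_measurable (obs_law P N)"
      if "x \<in> A" for x
      using q_measurable[OF that] B[OF that] by measurable
  qed (rule countable_alphabet)
  also have "\<dots> = (\<integral>\<^sup>+y. ennreal (q (L y) y) \<partial>obs_law P N)"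
  proof (rule nn_integral_cong)
    fix y assume "y \<in> space (obs_law P N)"
    then have y: "y \<in> space N" by simp
    \<comment> \<open>For this \<open>y\<close>, membership in \<open>B x\<close> means
      \<open>x = L y\<close>, so a single term of the sum survives.\<close>
    have "(\<integral>\<^sup>+x. ennreal (q x y) * indicator (B x) y \<partial>count_space A)
        = (\<integral>\<^sup>+x. ennreal (q (L y) y) * indicator {L y} x \<partial>count_space A)"
      by (rule nn_integral_cong) (use y in \<open>auto simp: B_def indicator_def\<close>)
    also have "\<dots> = ennreal (q (L y) y)"
      using LA[OF y] by (simp add: nn_integral_cmult_indicator)
    finally show "(\<integral>\<^sup>+x. ennreal (q x y) * indicator (B x) y \<partial>count_space A) = ennreal (q (L y) y)" .
  qed
  also have "\<dots> = ennreal (LINT y|obs_law P N. q (L y) y)"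
    by (rule nn_integral_eq_integral[OF i]) (auto intro!: q_nonneg LA)
  finally show "measure P {(x, y) \<in> space P. x = L y} = (LINT y|obs_law P N. q (L y) y)"
    by (subst measure_def) (auto intro!: enn2real_ennreal integral_nonneg_AE q_nonneg LA)
qed

lemma prob_error:
  assumes L: "L \<in> N \<rightarrow>\<^sub>M count_space A"
  shows "measure P {(x, y) \<in> space P. x \<noteq> L y} = 1 - (LINT y|obs_law P N. q (L y) y)"
proof -
  have "{(x, y) \<in> space P. x \<noteq> L y} = space P - {(x, y) \<in> space P. x = L y}" by auto
  then show ?thesis using prob_compl[OF prob_correct(1)[OF L]] prob_correct(3)[OF L] by simp
qed

text \<open>The measurable maximiser of \<open>q\<close> attains the minimum: any other rule has a
  pointwise smaller or equal integrand, hence no larger success probability. This gives the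
  \<open>LEAST\<close> in \<open>min_error_prob\<close> a concrete value.\<close>

lemma min_error_prob_MAP:
  obtains L where "L \<in> N \<rightarrow>\<^sub>M count_space A"
    and "min_error_prob P A N = 1 - (LINT y|obs_law P N. q (L y) y)"
proof -
  have "\<exists>x\<in>A. \<forall>z\<in>A. q z y \<le> q x y" if "y \<in> space N" for y
    using has_sum_nonneg_attains_max[OF q_has_sum[OF that]] q_nonneg that alphabet_nonempty by auto
  then obtain L where L: "L \<in> N \<rightarrow>\<^sub>M count_space A"
    and max: "\<And>y z. y \<in> space N \<Longrightarrow> z \<in> A \<Longrightarrow> q z y \<le> q (L y) y"
    using measurable_argmax[where q = q, OF countable_alphabet q_measurable] by blast
  have "min_error_prob P A N = 1 - (LINT y|obs_law P N. q (L y) y)"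
    unfolding min_error_prob_def
  proof (rule Least_equality)
    show "\<exists>L'\<in>N \<rightarrow>\<^sub>M count_space A. 1 - (LINT y|obs_law P N. q (L y) y)
        = measure P {(x, y) \<in> space P. x \<noteq> L' y}"
      using L prob_error[OF L] by force
  next
    fix e assume "\<exists>L'\<in>N \<rightarrow>\<^sub>M count_space A. e = measure P {(x, y) \<in> space P. x \<noteq> L' y}"
    then obtain L' where L': "L' \<in> N \<rightarrow>\<^sub>M count_space A"
      and "e = measure P {(x, y) \<in> space P. x \<noteq> L' y}" by blast
    then have e: "e = 1 - (LINT y|obs_law P N. q (L' y) y)"
      by (simp only: prob_error)
    have "(LINT y|obs_law P N. q (L' y) y) \<le> (LINT y|obs_law P N. q (L y) y)"
      using prob_correct(2)[OF L'] prob_correct(2)[OF L] max measurable_space[OF L']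
      by (intro integral_mono) auto
    then show "1 - (LINT y|obs_law P N. q (L y) y) \<le> e" using e by simp
  qed
  then show thesis using L that by blast
qed

section \<open>The bound by the expected norm\<close>

lemma integrable_cond_norm:
  assumes "\<alpha> > 1"
  shows "integrable (obs_law P N) (\<lambda>y. (\<Sum>\<^sub>\<infinity>x\<in>A. q x y powr \<alpha>) powr (1 / \<alpha>))"
proof (rule integrable_obs_law)
  have "(\<lambda>y. q x y powr \<alpha>) \<in> borel_measurable N" if "x \<in> A" for x
    using q_measurable[OF that] by measurable
  then have "(\<lambda>y. \<Sum>\<^sub>\<infinity>x\<in>A. q x y powr \<alpha>) \<in> borel_measurable N"
    using powr_summable_on(1)[OF q_has_sum q_nonneg \<open>\<alpha> > 1\<close>]
    by (intro borel_measurable_infsum_countable countable_alphabet) auto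
  then show "(\<lambda>y. (\<Sum>\<^sub>\<infinity>x\<in>A. q x y powr \<alpha>) powr (1 / \<alpha>)) \<in> borel_measurable N"
    by measurable
next
  fix y assume y: "y \<in> space N"
  have "0 \<le> (\<Sum>\<^sub>\<infinity>x\<in>A. q x y powr \<alpha>)" by (rule infsum_nonneg) simp
  then show "0 \<le> (\<Sum>\<^sub>\<infinity>x\<in>A. q x y powr \<alpha>) powr (1 / \<alpha>) \<and>
      (\<Sum>\<^sub>\<infinity>x\<in>A. q x y powr \<alpha>) powr (1 / \<alpha>) \<le> 1"
    using powr_summable_on(2)[OF q_has_sum[OF y] q_nonneg \<open>\<alpha> > 1\<close>] y \<open>\<alpha> > 1\<close>
    by (simp add: powr_le1)
qed

text \<open>The norm inequality, applied at the coordinate \<open>L y\<close> of the optimal rule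
  and integrated over \<open>y\<close>. It is the theorem before logarithms are taken.\<close>

lemma min_error_prob_ge:
  assumes "\<alpha> > 1"
  shows "min_error_prob P A N
    \<ge> 1 - (LINT y|obs_law P N. (\<Sum>\<^sub>\<infinity>x\<in>A. q x y powr \<alpha>) powr (1 / \<alpha>))"
proof -
  obtain L where L: "L \<in> N \<rightarrow>\<^sub>M count_space A"
    and eq: "min_error_prob P A N = 1 - (LINT y|obs_law P N. q (L y) y)"
    by (rule min_error_prob_MAP)
  have "q (L y) y \<le> (\<Sum>\<^sub>\<infinity>x\<in>A. q x y powr \<alpha>) powr (1 / \<alpha>)" if "y \<in> space N" for y
    using member_le_powr_infsum[OF q_has_sum[OF that] q_nonneg \<open>\<alpha> > 1\<close>] that
      measurable_space[OF L that] by simp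
  then have "(LINT y|obs_law P N. q (L y) y)
      \<le> (LINT y|obs_law P N. (\<Sum>\<^sub>\<infinity>x\<in>A. q x y powr \<alpha>) powr (1 / \<alpha>))"
    by (intro integral_mono prob_correct(2)[OF L] integrable_cond_norm[OF \<open>\<alpha> > 1\<close>]) auto
  then show ?thesis using eq by simp
qed

text \<open>The attained minimum is itself the probability of an error event. In the theorem this
  settles the case of a vanishing expectation, where the claimed bound is 0.\<close>

lemma min_error_prob_nonneg: "min_error_prob P A N \<ge> 0"
proof -
  obtain L where "L \<in> N \<rightarrow>\<^sub>M count_space A"
    and "min_error_prob P A N = 1 - (LINT y|obs_law P N. q (L y) y)"
    by (rule min_error_prob_MAP)
  then show ?thesis by (simp flip: prob_error)
qed

end

theorem theorem7:
  fixes P :: "('a \<times> 'b) measure" and A :: "'a set" and N :: "'b measure"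
    and q :: "'a \<Rightarrow> 'b \<Rightarrow> real" and b \<alpha> :: real
  assumes "countable A"
    and "prob_space P"
    and "sets P = sets (count_space A \<Otimes>\<^sub>M N)"
    and "cond_pmf_version P A N q"
    and "\<And>x y. x \<in> A \<Longrightarrow> y \<in> space N \<Longrightarrow> q x y > 0"
    and "b > 1"
    and "\<alpha> > 1"
  shows "min_error_prob P A N \<ge>
           1 - b powr ((1 - \<alpha>) / \<alpha> * arimoto_renyi_cond_entropy b \<alpha> P A N q)"
proof -
  interpret joint_law P A N q
    using assms by (simp add: joint_law_def joint_law_axioms_def)
  define E where "E = (LINT y|obs_law P N. (\<Sum>\<^sub>\<infinity>x\<in>A. q x y powr \<alpha>) powr (1 / \<alpha>))"
  \<comment> \<open>The prefactor is the reciprocal of the one in the entropy, so only the logarithm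
    remains.\<close>
  have "(1 - \<alpha>) / \<alpha> * arimoto_renyi_cond_entropy b \<alpha> P A N q = log b E"
    using \<open>\<alpha> > 1\<close> by (simp add: arimoto_renyi_cond_entropy_def E_def)
  moreover have "E \<ge> 0" unfolding E_def by (intro integral_nonneg_AE) simp
  \<comment> \<open>The junk value \<open>log b 0 = 0\<close> makes the bound trivial for \<open>E = 0\<close>.\<close>
  then have "1 - b powr log b E \<le> min_error_prob P A N"
    using min_error_prob_ge[OF \<open>\<alpha> > 1\<close>] min_error_prob_nonneg \<open>b > 1\<close>
    by (cases "E = 0") (auto simp: E_def[symmetric] log_def[of b 0])
  ultimately show ?thesis by simp
qed

end
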